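(* Let $T$ be a weak mixing $\mathbb{Z}^d$-action on $(X,\mu)$ and let $\overline T$ be an embedding of $T$ in an $\mathbb{R}^d$-action. Then $T$ is weak mixing in a direction $L\in\mathbb{G}_{e,d}$ if and only if the restriction $\overline T^{|L}=\{\overline T^{\vec t}\}_{\vec t\in L}$ is weak mixing.
   Context: All actions are free measurable measure preserving actions on a Lebesgue probability space $(X,\mu)$. $\mathbb{G}_{e,d}$ is the set of $e$-dimensional linear subspaces of $\mathbb{R}^d$, and directional properties are considered for $1\le e\le d$. An embedding of a $\mathbb{Z}^d$-action $T$ is an $\mathbb{R}^d$-action $\overline T$ on the same space $(X,\mu)$ with $\overline T^{\vec n}=T^{\vec n}$ for all $\vec n\in\mathbb{Z}^d$. An action is weak mixing if the only $L^2$ eigenfunctions are constants. Unit suspension. $\widetilde T$ is the $\mathbb{R}^d$-action on $(\widetilde X,\tilde\mu)=(X\times[0,1)^d,\mu\times\lambda)$, $\lambda$ Lebesgue measure, given by $\widetilde T^{\vec t}(x,\vec r)=(T^{\lfloor\vec t+\vec r\rfloor}x,\{\vec t+\vec r\})$, with componentwise integer part $\lfloor\cdot\rfloor$ and fractional part $\{\cdot\}$. Let $\mathcal{O}=\{F(x,\vec s)=f(\vec s): f\in L^2([0,1)^d,\lambda)\}\subseteq L^2(\widetilde X,\tilde\mu)$ and $L^2_{\mathcal{O}}(\widetilde X,\tilde\mu)=\mathcal{O}^\perp$. The $\mathbb{Z}^d$-action $T$ is weak mixing in the direction $L$ if there is no nonzero $F\in L^2_{\mathcal{O}}(\widetilde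 X,\tilde\mu)$ such that, for some $\vec\ell\in L$, $F(\widetilde T^{\vec t}y)=e^{2\pi i\vec\ell\cdot\vec t}F(y)$ for all $\vec t\in L$ and a.e. $y$. *)

theory Defs
  imports "HOL-Probability.Probability"
begin

section \<open>Lebesgue probability spaces\<close>

text \<open>A complete probability space that is isomorphic modulo null sets to the unit interval
  with Lebesgue measure. Rokhlin's definition also admits atoms, but a space with atoms carries
  no free measure preserving action of an infinite group.\<close>

definition lebesgue_probability_space :: "'a measure \<Rightarrow> bool" where
  "lebesgue_probability_space M \<longleftrightarrow>
     prob_space M \<and> complete_measure M \<and>
     (\<exists>A B \<phi> \<psi>. A \<in> sets M \<and> space M - A \<in> null_sets M \<and>
        B \<in> sets lebesgue \<and> B \<subseteq> {0..1::real} \<and> {0..1} - B \<in> null_sets lebesgue \<and>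
        \<phi> \<in> restrict_space M A \<rightarrow>\<^sub>M lebesgue_on B \<and>
        \<psi> \<in> lebesgue_on B \<rightarrow>\<^sub>M restrict_space M A \<and>
        (\<forall>x\<in>A. \<psi> (\<phi> x) = x) \<and> (\<forall>y\<in>B. \<phi> (\<psi> y) = y) \<and>
        distr (restrict_space M A) (lebesgue_on B) \<phi> = lebesgue_on B)"


section \<open>Free measure preserving actions\<close>

definition measure_preserving_map :: "'a measure \<Rightarrow> ('a \<Rightarrow> 'a) \<Rightarrow> bool" where
  "measure_preserving_map M f \<longleftrightarrow> f \<in> M \<rightarrow>\<^sub>M M \<and> distr M M f = M"

definition mp_action :: "'a measure \<Rightarrow> ('g::ab_group_add \<Rightarrow> 'a \<Rightarrow> 'a) \<Rightarrow> bool" where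
  "mp_action M T \<longleftrightarrow>
     (\<forall>g. measure_preserving_map M (T g)) \<and>
     (\<forall>x\<in>space M. T 0 x = x) \<and>
     (\<forall>g h. \<forall>x\<in>space M. T (g + h) x = T g (T h x))"

definition free_action :: "'a measure \<Rightarrow> ('g::ab_group_add \<Rightarrow> 'a \<Rightarrow> 'a) \<Rightarrow> bool" where
  "free_action M T \<longleftrightarrow> (AE x in M. \<forall>g. g \<noteq> 0 \<longrightarrow> T g x \<noteq> x)"

definition Zd_action :: "'a measure \<Rightarrow> (int^'d \<Rightarrow> 'a \<Rightarrow> 'a) \<Rightarrow> bool" where
  "Zd_action M T \<longleftrightarrow> mp_action M T \<and> free_action M T"

text \<open>Joint measurability refers to the completed product, since \<open>M\<close> is complete: already for
  a rotation flow on the circle, the preimage of a non-Borel Lebesgue null set need not lie in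
  the uncompleted product sigma-algebra.\<close>

definition Rd_action :: "'a measure \<Rightarrow> (real^'d \<Rightarrow> 'a \<Rightarrow> 'a) \<Rightarrow> bool" where
  "Rd_action M S \<longleftrightarrow> mp_action M S \<and> free_action M S \<and>
     (\<lambda>(t, x). S t x) \<in> completion (lborel \<Otimes>\<^sub>M M) \<rightarrow>\<^sub>M M"

definition real_vec :: "int^'d \<Rightarrow> real^'d" where
  "real_vec n = (\<chi> i. real_of_int (n $ i))"

text \<open>As usual, measure preserving maps are identified when they agree almost everywhere.\<close>

definition embedding :: "'a measure \<Rightarrow> (int^'d \<Rightarrow> 'a \<Rightarrow> 'a) \<Rightarrow> (real^'d \<Rightarrow> 'a \<Rightarrow> 'a) \<Rightarrow> bool" where
  "embedding M T S \<longleftrightarrow> Rd_action M S \<and> (\<forall>n. AE x in M. S (real_vec n) x = T n x)"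


section \<open>Eigenfunctions and weak mixing\<close>

text \<open>Elements of \<open>L\<^sup>2\<close> are represented by functions, not by equivalence classes.\<close>

definition L2 :: "'a measure \<Rightarrow> ('a \<Rightarrow> complex) set" where
  "L2 M = {f \<in> borel_measurable M. integrable M (\<lambda>x. (norm (f x))\<^sup>2)}"

definition character :: "real^'d \<Rightarrow> real^'d \<Rightarrow> complex" where
  "character l t = exp (2 * complex_of_real pi * \<i> * complex_of_real (l \<bullet> t))"

definition Zd_eigenfunction ::
  "'a measure \<Rightarrow> (int^'d \<Rightarrow> 'a \<Rightarrow> 'a) \<Rightarrow> real^'d \<Rightarrow> ('a \<Rightarrow> complex) \<Rightarrow> bool" where
  "Zd_eigenfunction M T l f \<longleftrightarrow> f \<in> L2 M \<and> \<not> (AE x in M. f x = 0) \<and>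
     (\<forall>n. AE x in M. f (T n x) = character l (real_vec n) * f x)"

definition Zd_weak_mixing :: "'a measure \<Rightarrow> (int^'d \<Rightarrow> 'a \<Rightarrow> 'a) \<Rightarrow> bool" where
  "Zd_weak_mixing M T \<longleftrightarrow>
     (\<forall>l f. Zd_eigenfunction M T l f \<longrightarrow> (\<exists>c. AE x in M. f x = c))"

text \<open>For the restriction \<open>(S t)\<^bsub>t \<in> L\<^esub>\<close> to a linear subspace \<open>L\<close>; the continuous characters of
  \<open>L\<close> are the functions \<^term>\<open>character l\<close> with \<open>l \<in> L\<close>.\<close>

definition eigenfunction_on ::
  "(real^'d) set \<Rightarrow> 'a measure \<Rightarrow> (real^'d \<Rightarrow> 'a \<Rightarrow> 'a) \<Rightarrow> real^'d \<Rightarrow> ('a \<Rightarrow> complex) \<Rightarrow> bool" where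
  "eigenfunction_on L M S l f \<longleftrightarrow> l \<in> L \<and> f \<in> L2 M \<and> \<not> (AE x in M. f x = 0) \<and>
     (\<forall>t\<in>L. AE x in M. f (S t x) = character l t * f x)"

definition weak_mixing_on ::
  "(real^'d) set \<Rightarrow> 'a measure \<Rightarrow> (real^'d \<Rightarrow> 'a \<Rightarrow> 'a) \<Rightarrow> bool" where
  "weak_mixing_on L M S \<longleftrightarrow>
     (\<forall>l f. eigenfunction_on L M S l f \<longrightarrow> (\<exists>c. AE x in M. f x = c))"


section \<open>Unit suspension and directional weak mixing\<close>

definition unit_cube :: "(real^'d) measure" where
  "unit_cube = restrict_space lborel {r. \<forall>i. 0 \<le> r $ i \<and> r $ i < 1}"

definition vec_floor :: "real^'d \<Rightarrow> int^'d" where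
  "vec_floor v = (\<chi> i. \<lfloor>v $ i\<rfloor>)"

definition vec_frac :: "real^'d \<Rightarrow> real^'d" where
  "vec_frac v = (\<chi> i. frac (v $ i))"

definition susp_measure :: "'a measure \<Rightarrow> ('a \<times> (real^'d)) measure" where
  "susp_measure M = M \<Otimes>\<^sub>M unit_cube"

definition suspension ::
  "(int^'d \<Rightarrow> 'a \<Rightarrow> 'a) \<Rightarrow> real^'d \<Rightarrow> 'a \<times> (real^'d) \<Rightarrow> 'a \<times> (real^'d)" where
  "suspension T t = (\<lambda>(x, r). (T (vec_floor (t + r)) x, vec_frac (t + r)))"

definition fibre_functions :: "('a \<times> (real^'d) \<Rightarrow> complex) set" where
  "fibre_functions = {F. \<exists>f\<in>L2 unit_cube. F = (\<lambda>(x, s). f s)}"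

definition L2_O :: "'a measure \<Rightarrow> ('a \<times> (real^'d) \<Rightarrow> complex) set" where
  "L2_O M = {F \<in> L2 (susp_measure M).
     \<forall>G\<in>fibre_functions. (\<integral>y. F y * cnj (G y) \<partial>susp_measure M) = 0}"

definition directional_weak_mixing ::
  "(real^'d) set \<Rightarrow> 'a measure \<Rightarrow> (int^'d \<Rightarrow> 'a \<Rightarrow> 'a) \<Rightarrow> bool" where
  "directional_weak_mixing L M T \<longleftrightarrow>
     \<not> (\<exists>F\<in>L2_O M. \<exists>l. eigenfunction_on L (susp_measure M) (suspension T) l F)"

definition grassmannian :: "nat \<Rightarrow> (real^'d) set set" where
  "grassmannian e = {L. subspace L \<and> dim L = e}"

end

theory Submission
  imports Defs "HOL-Complex_Analysis.Cauchy_Integral_Theorem"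
begin

text \<open>
  Write \<open>R\<close> for the rotation action \<open>R t r = vec_frac (t + r)\<close> of \<open>\<real>\<^sup>d\<close> on the torus \<open>[0,1)\<^sup>d\<close>.
  Since \<open>t + r\<close> is the sum of its integer and fractional parts and \<open>T\<close> agrees almost everywhere
  with \<open>S\<close> on the integer vectors, the map \<open>(x, r) \<mapsto> (S r x, r)\<close> conjugates the suspension of \<open>T\<close> to the
  product action \<open>S \<times> R\<close> (lemma \<open>floor_plus_frac_S\<close>), and it fixes every function of \<open>r\<close> alone. The
  assertion is therefore that \<open>S\<close> restricted to \<open>L\<close> is weak mixing iff every eigenfunction of
  \<open>S \<times> R\<close> restricted to \<open>L\<close> that is orthogonal to the functions of \<open>r\<close> vanishes.

  A nonconstant eigenfunction remains an eigenfunction for the same character when its mean is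
  subtracted. If \<open>f\<close> is an eigenfunction of \<open>S\<close> on \<open>L\<close> with mean zero, then \<open>f(S r x)\<close> is an
  eigenfunction of the suspension with the same character, and its integral over \<open>x\<close> is zero for
  almost every \<open>r\<close>, so it is orthogonal to the functions of \<open>r\<close> (\<open>ex_suspension_eigenfunction\<close>).

  Conversely, let \<open>G\<close> be an eigenfunction of \<open>S \<times> R\<close> on \<open>L\<close>. Its Fourier coefficients in \<open>r\<close>,
  \<open>c\<^sub>k(x) = \<integral> exp(2 \<pi> i k \<bullet> r) G(x, r) dr\<close>, are eigenfunctions of \<open>S\<close> on \<open>L\<close>, because the
  characters are eigenfunctions of \<open>R\<close>. If \<open>S\<close> is weak mixing on \<open>L\<close>, they are constant, and
  uniqueness of Fourier coefficients on the torus (\<open>fourier_null_imp_zero\<close>) gives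
  \<open>G(x, r) = G(x\<^sub>0, r)\<close> almost everywhere for a suitable \<open>x\<^sub>0\<close>
  (\<open>suspension_eigenfunction_fibre\<close>). A square integrable function of \<open>r\<close> that is
  orthogonal to all such functions is zero (\<open>L2_O_fibre_imp_zero\<close>).

  Integrability is kept trivial by passing from an eigenfunction \<open>f\<close> to the bounded function
  \<open>f / (1 + \<bar>f\<bar>)\<close>, which is an eigenfunction for the same character and determines \<open>f\<close>.
  The conjugacy need only be measurable with respect to the completed product measure; almost everywhere
  identities are therefore stated fibrewise, for almost all \<open>r\<close> and then almost all \<open>x\<close>, where
  only the single maps \<open>S t\<close> and the rotation are substituted, and they are turned into statements
  about the product measure by Fubini's theorem for the completion (\<open>AE_pair_fibrewiseI\<close>).
\<close>

section \<open>The unit cube as a torus\<close>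

definition cube :: "(real^'d) set" where
  "cube = {r. \<forall>i. 0 \<le> r $ i \<and> r $ i < 1}"

lemma cube_borel [measurable, simp]: "(cube :: (real^'d) set) \<in> sets borel"
  unfolding cube_def by measurable

lemma unit_cube_eq: "unit_cube = restrict_space lborel cube"
  unfolding unit_cube_def cube_def ..

lemma space_unit_cube [simp]: "space unit_cube = cube"
  by (simp add: unit_cube_eq space_restrict_space)

lemma sets_unit_cube: "sets unit_cube = sets (restrict_space borel cube)"
  by (simp add: unit_cube_eq sets_restrict_space)

lemma emeasure_unit_cube: "A \<in> sets unit_cube \<Longrightarrow> emeasure unit_cube A = emeasure lborel A"
  unfolding unit_cube_eq by (subst emeasure_restrict_space) (auto simp: sets_restrict_space_iff)

lemma sets_unit_cube_iff: "A \<in> sets unit_cube \<longleftrightarrow> A \<in> sets borel \<and> A \<subseteq> cube"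
  by (auto simp: unit_cube_eq sets_restrict_space_iff)

lemma measurable_unit_cube_borel: "f \<in> borel \<rightarrow>\<^sub>M N \<Longrightarrow> f \<in> unit_cube \<rightarrow>\<^sub>M N"
  by (simp add: unit_cube_eq measurable_restrict_space1)

lemma measurable_vec_frac [measurable]: "vec_frac \<in> borel \<rightarrow>\<^sub>M (borel :: (real^'d) measure)"
proof (rule borel_measurable_euclidean_space[THEN iffD2], intro ballI)
  fix b :: "real^'d" assume "b \<in> Basis"
  then obtain i where b: "b = axis i 1" by (auto simp: Basis_vec_def)
  have "(\<lambda>v::real^'d. frac (v $ i)) \<in> borel_measurable borel"
    unfolding frac_def by measurable
  then show "(\<lambda>x::real^'d. vec_frac x \<bullet> b) \<in> borel_measurable borel"
    by (simp add: b inner_axis vec_frac_def)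
qed

lemma measurable_vec_floor [measurable]: "vec_floor \<in> borel \<rightarrow>\<^sub>M (count_space UNIV :: (int^'d) measure)"
proof (subst measurable_count_space_eq_countable, simp, intro conjI ballI)
  fix n :: "int^'d"
  have "vec_floor -` {n} \<inter> space borel = {v. \<forall>i. \<lfloor>v $ i\<rfloor> = n $ i}"
    by (auto simp: vec_floor_def vec_eq_iff)
  also have "\<dots> \<in> sets borel" by measurable
  finally show "vec_floor -` {n} \<inter> space borel \<in> sets borel" .
qed auto

lemma vec_frac_in_cube [simp]: "vec_frac v \<in> cube"
  by (simp add: cube_def vec_frac_def frac_lt_1)

lemma vec_floor_plus_frac: "real_vec (vec_floor v) + vec_frac v = v"
  by (simp add: vec_eq_iff real_vec_def vec_floor_def vec_frac_def frac_def)

text \<open>The integer translates of the cube tile the space.\<close>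

lemma vec_floor_eq_iff: "vec_floor v = n \<longleftrightarrow> v - real_vec n \<in> cube"
  by (auto simp: vec_eq_iff vec_floor_def real_vec_def cube_def floor_eq_iff) (smt (verit))+

lemma prob_space_unit_cube: "prob_space (unit_cube :: (real^'d) measure)"
proof
  have one: "(1 :: real^'d) \<bullet> b = 1" if "b \<in> Basis" for b
    using that by (auto simp: Basis_vec_def inner_axis)
  have "emeasure lborel (box 0 (1::real^'d)) \<le> emeasure lborel (cube::(real^'d) set)"
    by (rule emeasure_mono) (auto simp: mem_box_cart cube_def less_imp_le)
  moreover have "emeasure lborel (cube::(real^'d) set) \<le> emeasure lborel (cbox 0 (1::real^'d))"
    by (rule emeasure_mono) (auto simp: mem_box_cart cube_def less_imp_le)
  ultimately have "emeasure lborel (cube::(real^'d) set) = 1"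
    by (simp add: emeasure_lborel_cbox_eq emeasure_lborel_box_eq one)
  then show "emeasure unit_cube (space unit_cube :: (real^'d) set) = 1"
    by (simp add: emeasure_unit_cube sets_unit_cube_iff)
qed

lemma measurable_rotation: "(\<lambda>r. vec_frac (t + r)) \<in> unit_cube \<rightarrow>\<^sub>M unit_cube"
proof -
  have "(\<lambda>r. vec_frac (t + r)) \<in> borel \<rightarrow>\<^sub>M restrict_space borel cube"
    by (rule measurable_restrict_space2) auto
  from measurable_unit_cube_borel[OF this] show ?thesis
    by (simp cong: measurable_cong_sets add: sets_unit_cube)
qed

text \<open>The rotation cuts the cube into the pieces on which the integer part of \<open>t + r\<close> is constant
  and translates each of them; the translated pieces tile the cube again.\<close>

lemma distr_rotation: "distr unit_cube unit_cube (\<lambda>r. vec_frac (t + r)) = (unit_cube :: (real^'d) measure)"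
proof (rule measure_eqI)
  fix A :: "(real^'d) set"
  assume "A \<in> sets (distr unit_cube unit_cube (\<lambda>r. vec_frac (t + r)))"
  then have A: "A \<in> sets unit_cube" by simp
  then have Ab [measurable]: "A \<in> sets borel" and Ac: "A \<subseteq> cube" by (auto simp: sets_unit_cube_iff)
  define B where "B n = {r. r \<in> cube \<and> t + r - real_vec n \<in> A}" for n
  define C where "C n = {s. s \<in> A \<and> s - t + real_vec n \<in> cube}" for n
  have BB: "B n \<in> sets borel" and CC: "C n \<in> sets borel" for n
    unfolding B_def C_def by measurable
  have BC: "emeasure lborel (B n) = emeasure lborel (C n)" for n
  proof -
    have "emeasure lborel (C n) = emeasure (distr lborel borel ((+) (t - real_vec n))) (C n)"
      by (simp add: lborel_distr_plus)
    also have "\<dots> = emeasure lborel (B n)"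
      using CC by (subst emeasure_distr) (auto simp: B_def C_def algebra_simps intro!: arg_cong2[where f=emeasure])
    finally show ?thesis ..
  qed
  have dB: "disjoint_family B"
    unfolding disjoint_family_on_def
    using Ac by (auto simp: B_def) (metis vec_floor_eq_iff subsetD)
  have dC: "disjoint_family C"
  proof -
    have "m = n" if "s - t + real_vec m \<in> cube" "s - t + real_vec n \<in> cube" for s m n
    proof -
      have "s - t - real_vec (- m) \<in> cube" "s - t - real_vec (- n) \<in> cube"
        using that by (auto simp: cube_def real_vec_def)
      then have "- m = - n" by (metis vec_floor_eq_iff)
      then show ?thesis by simp
    qed
    then show ?thesis unfolding disjoint_family_on_def by (auto simp: C_def)
  qed
  have uB: "(\<lambda>r. vec_frac (t + r)) -` A \<inter> cube = (\<Union>n. B n)"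
  proof -
    have "vec_frac (t + r) \<in> A \<longleftrightarrow> (\<exists>n. t + r - real_vec n \<in> A)" for r
    proof -
      have "vec_frac (t + r) = t + r - real_vec (vec_floor (t+r))"
        using vec_floor_plus_frac[of "t+r"] by (metis add_diff_cancel_left')
      then show ?thesis using Ac by (metis vec_floor_eq_iff subsetD)
    qed
    then show ?thesis by (auto simp: B_def)
  qed
  have uC: "A = (\<Union>n. C n)"
  proof -
    have "s - t + real_vec (- vec_floor (s - t)) \<in> cube" for s
      using vec_floor_eq_iff[of "s - t" "vec_floor (s-t)"]
      by (simp add: cube_def real_vec_def)
    then show ?thesis by (auto simp: C_def)
  qed
  have "emeasure (distr unit_cube unit_cube (\<lambda>r. vec_frac (t + r))) A
      = emeasure unit_cube ((\<lambda>r. vec_frac (t + r)) -` A \<inter> cube)"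
    using A by (simp add: emeasure_distr measurable_rotation)
  also have "\<dots> = emeasure lborel (\<Union>n. B n)"
    using measurable_sets[OF measurable_rotation A, of t] unfolding uB[symmetric]
    by (intro emeasure_unit_cube) simp
  also have "\<dots> = (\<integral>\<^sup>+n. emeasure lborel (B n) \<partial>count_space UNIV)"
    using BB dB by (intro emeasure_UN_countable) auto
  also have "\<dots> = (\<integral>\<^sup>+n. emeasure lborel (C n) \<partial>count_space UNIV)"
    by (simp add: BC)
  also have "\<dots> = emeasure lborel (\<Union>n. C n)"
    using CC dC by (intro emeasure_UN_countable[symmetric]) auto
  also have "\<dots> = emeasure unit_cube A" using A uC by (simp add: emeasure_unit_cube)
  finally show "emeasure (distr unit_cube unit_cube (\<lambda>r. vec_frac (t + r))) A = emeasure unit_cube A" .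
qed simp

section \<open>Uniqueness of Fourier coefficients on the torus\<close>

lemma character_add_left: "character (k + l) t = character k t * character l t"
  by (simp add: character_def inner_add_left distrib_left exp_add)

lemma character_add_right: "character l (s + t) = character l s * character l t"
  by (simp add: character_def inner_add_right distrib_left exp_add)

lemma character_0 [simp]: "character 0 t = 1" "character l 0 = 1"
  by (simp_all add: character_def)

lemma norm_character [simp]: "norm (character l t) = 1"
  by (simp add: character_def)

lemma measurable_character [measurable]: "character l \<in> borel_measurable borel"
  unfolding character_def by measurable

text \<open>The integer characters descend to the torus, since they are trivial on integer vectors.\<close>

lemma character_integer: "character (real_vec k) (real_vec n) = 1"
proof -
  define m where "m = (\<Sum>i\<in>UNIV. k $ i * n $ i)"
  have "real_vec k \<bullet> real_vec n = of_int m"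
    by (simp add: m_def inner_vec_def real_vec_def)
  then have "character (real_vec k) (real_vec n) = exp ((2 * of_int m * of_real pi) * \<i>)"
    by (simp add: character_def mult_ac)
  also have "\<dots> = 1" using exp_integer_2pi[of "of_int m"] by simp
  finally show ?thesis .
qed

lemma character_vec_frac: "character (real_vec k) (vec_frac v) = character (real_vec k) v"
proof -
  have "character (real_vec k) v = character (real_vec k) (real_vec (vec_floor v) + vec_frac v)"
    by (simp only: vec_floor_plus_frac)
  then show ?thesis by (simp add: character_add_right character_integer)
qed

text \<open>Bounded functions on the torus with vanishing Fourier coefficients. This class is closed under
  multiplication by characters, hence by trigonometric polynomials; that closure is what makes the
  induction over polynomials in \<open>fourier_null_polynomial\<close> possible.\<close>

definition fourier_null :: "(real^'d \<Rightarrow> complex) \<Rightarrow> bool" where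
  "fourier_null h \<longleftrightarrow> h \<in> borel_measurable unit_cube \<and> (\<exists>B. AE r in unit_cube. norm (h r) \<le> B) \<and>
     (\<forall>k. (\<integral>r. character (real_vec k) r * h r \<partial>unit_cube) = 0)"

lemma integrable_unit_cube_bounded:
  fixes h :: "real^'d \<Rightarrow> complex"
  assumes "h \<in> borel_measurable unit_cube" "AE r in unit_cube. norm (h r) \<le> B"
  shows "integrable unit_cube h"
  using prob_space_unit_cube finite_measure.integrable_const_bound assms
  by (metis prob_space_def)

lemma fourier_null_integrable:
  fixes h :: "real^'d \<Rightarrow> complex"
  assumes "fourier_null h"
  shows "integrable unit_cube (\<lambda>r. character l r * h r)"
proof -
  obtain B where B: "AE r in unit_cube. norm (h r) \<le> B" and [measurable]: "h \<in> borel_measurable unit_cube"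
    using assms by (auto simp: fourier_null_def)
  have [measurable]: "character l \<in> borel_measurable unit_cube"
    by (simp add: measurable_unit_cube_borel)
  show ?thesis
    by (rule integrable_unit_cube_bounded[where B=B]) (use B in \<open>auto simp: norm_mult\<close>)
qed

lemma fourier_null_character:
  assumes "fourier_null h"
  shows "fourier_null (\<lambda>r. character (real_vec k) r * h r)"
proof -
  obtain B where B: "AE r in unit_cube. norm (h r) \<le> B" and [measurable]: "h \<in> borel_measurable unit_cube"
    using assms by (auto simp: fourier_null_def)
  have [measurable]: "character l \<in> borel_measurable unit_cube" for l :: "real^'b"
    by (simp add: measurable_unit_cube_borel)
  have "character (real_vec k') r * (character (real_vec k) r * h r) = character (real_vec (k' + k)) r * h r" for k' r
  proof -
    have "real_vec (k' + k) = real_vec k' + real_vec k" by (simp add: real_vec_def vec_eq_iff)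
    then show ?thesis by (simp add: character_add_left)
  qed
  then have "(\<integral>r. character (real_vec k') r * (character (real_vec k) r * h r) \<partial>unit_cube) = 0" for k'
    using assms by (simp only: fourier_null_def)
  moreover have "(\<lambda>r. character (real_vec k) r * h r) \<in> borel_measurable unit_cube"
    by measurable
  moreover have "AE r in unit_cube. norm (character (real_vec k) r * h r) \<le> B"
    using B by (simp add: norm_mult)
  ultimately show ?thesis unfolding fourier_null_def by blast
qed

lemma fourier_null_add:
  assumes "fourier_null g" "fourier_null h"
  shows "fourier_null (\<lambda>r. g r + h r)"
proof -
  obtain B where B: "AE r in unit_cube. norm (g r) \<le> B" and [measurable]: "g \<in> borel_measurable unit_cube"
    using assms by (auto simp: fourier_null_def)
  obtain C where C: "AE r in unit_cube. norm (h r) \<le> C" and [measurable]: "h \<in> borel_measurable unit_cube"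
    using assms by (auto simp: fourier_null_def)
  have "AE r in unit_cube. norm (g r + h r) \<le> B + C"
    using B C by eventually_elim (metis add_mono norm_triangle_le)
  then show ?thesis
    using assms fourier_null_integrable[OF assms(1)] fourier_null_integrable[OF assms(2)]
    by (auto simp: fourier_null_def distrib_left)
qed

lemma fourier_null_cmult:
  assumes "fourier_null h"
  shows "fourier_null (\<lambda>r. c * h r)"
proof -
  obtain B where B: "AE r in unit_cube. norm (h r) \<le> B" and [measurable]: "h \<in> borel_measurable unit_cube"
    using assms by (auto simp: fourier_null_def)
  have "AE r in unit_cube. norm (c * h r) \<le> norm c * B"
    using B by eventually_elim (simp add: norm_mult mult_left_mono)
  then show ?thesis
    using assms by (auto simp: fourier_null_def mult.left_commute[of _ c])
qed

lemma fourier_null_sum: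
  assumes "finite I" "\<And>i. i \<in> I \<Longrightarrow> fourier_null (h i)"
  shows "fourier_null (\<lambda>r. \<Sum>i\<in>I. h i r)"
  using assms
proof (induction I rule: finite_induct)
  case empty
  have "\<exists>B. AE r in unit_cube. 0 \<le> (B::real)" by (intro exI[of _ 0]) simp
  then show ?case by (simp add: fourier_null_def)
next
  case (insert i I)
  then show ?case by (simp add: fourier_null_add)
qed

text \<open>The torus as a subset of \<open>\<complex>\<^sup>d\<close>. In this model trigonometric polynomials are the real
  polynomials in the coordinates, so that the Stone-Weierstrass theorem for polynomials applies.\<close>

definition torus_emb :: "real^'d \<Rightarrow> complex^'d" where
  "torus_emb r = (\<chi> i. cis (2 * pi * r $ i))"

lemma cis_eq_character:
  "cis (2 * pi * r $ i) = character (real_vec (axis i 1)) r"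
  "cis (- (2 * pi * r $ i)) = character (real_vec (- axis i 1)) r"
proof -
  have "real_vec (axis i 1) = axis i 1" "real_vec (- axis i 1) = - axis i 1"
    by (simp_all add: real_vec_def vec_eq_iff axis_def)
  then show "cis (2 * pi * r $ i) = character (real_vec (axis i 1)) r"
    "cis (- (2 * pi * r $ i)) = character (real_vec (- axis i 1)) r"
    by (simp_all add: character_def cis_conv_exp inner_axis' mult_ac)
qed

text \<open>The real coordinates of \<open>\<complex>\<^sup>d\<close> restrict to cosines and sines on the torus, that is, to
  combinations of two integer characters.\<close>

lemma fourier_null_torus_coordinate:
  fixes h :: "real^'d \<Rightarrow> complex"
  assumes h: "fourier_null h" and b: "b \<in> Basis"
  shows "fourier_null (\<lambda>r. complex_of_real (torus_emb r \<bullet> b) * h r)"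
proof -
  obtain i u where b: "b = axis i u" and u: "u = 1 \<or> u = \<i>"
    using b by (auto simp: Basis_vec_def Basis_complex_def)
  define p where "p r = character (real_vec (axis i 1)) r" for r :: "real^'d"
  define q where "q r = character (real_vec (- axis i 1)) r" for r :: "real^'d"
  have p: "fourier_null (\<lambda>r. p r * h r)" and q: "fourier_null (\<lambda>r. q r * h r)"
    unfolding p_def q_def by (rule fourier_null_character[OF h])+
  show ?thesis
  proof (cases "u = 1")
    case True
    have "complex_of_real (torus_emb r \<bullet> b) * h r = 1/2 * (p r * h r) + 1/2 * (q r * h r)" for r
    proof -
      have "complex_of_real (torus_emb r \<bullet> b) = 1/2 * p r + 1/2 * q r"
        unfolding p_def q_def cis_eq_character[symmetric] b True
        by (simp add: inner_axis torus_emb_def complex_eq_iff)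
      then show ?thesis by (simp add: algebra_simps)
    qed
    then show ?thesis
      using fourier_null_add[OF fourier_null_cmult[OF p, of "1/2"] fourier_null_cmult[OF q, of "1/2"]] by simp
  next
    case False
    have "complex_of_real (torus_emb r \<bullet> b) * h r = (- \<i>/2) * (p r * h r) + (\<i>/2) * (q r * h r)" for r
    proof -
      have "complex_of_real (torus_emb r \<bullet> b) = (- \<i>/2) * p r + (\<i>/2) * q r"
        unfolding p_def q_def cis_eq_character[symmetric] b using u False
        by (auto simp add: inner_axis torus_emb_def inner_complex_def complex_eq_iff)
      then show ?thesis by (metis distrib_right mult.assoc)
    qed
    then show ?thesis
      using fourier_null_add[OF fourier_null_cmult[OF p, of "- \<i>/2"] fourier_null_cmult[OF q, of "\<i>/2"]] by simp
  qed
qed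

lemma fourier_null_polynomial:
  fixes p :: "complex^'d \<Rightarrow> real" and h :: "real^'d \<Rightarrow> complex"
  assumes "real_polynomial_function p" "fourier_null h"
  shows "fourier_null (\<lambda>r. complex_of_real (p (torus_emb r)) * h r)"
  using assms
proof (induction p arbitrary: h rule: real_polynomial_function.induct)
  case (linear f)
  have "complex_of_real (f (torus_emb r)) * h r
      = (\<Sum>b\<in>Basis. complex_of_real (f b) * (complex_of_real (torus_emb r \<bullet> b) * h r))" for r
  proof -
    have "f (torus_emb r) = (\<Sum>b\<in>Basis. (torus_emb r \<bullet> b) * f b)"
    proof -
      interpret bounded_linear f by fact
      have "f (\<Sum>b\<in>Basis. (torus_emb r \<bullet> b) *\<^sub>R b) = (\<Sum>b\<in>Basis. (torus_emb r \<bullet> b) * f b)"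
        by (simp add: sum scaleR)
      then show ?thesis by (simp add: euclidean_representation)
    qed
    then show ?thesis
      by (simp only: of_real_sum of_real_mult sum_distrib_right) (intro sum.cong refl, simp only: mult_ac)
  qed
  moreover have "fourier_null (\<lambda>r. \<Sum>b\<in>Basis. complex_of_real (f b) * (complex_of_real (torus_emb r \<bullet> b) * h r))"
    by (intro fourier_null_sum[OF finite_Basis] fourier_null_cmult[OF fourier_null_torus_coordinate[OF linear(2)]])
  ultimately show ?case by (simp only:)
next
  case (const c)
  then show ?case by (simp add: fourier_null_cmult)
next
  case (add f g)
  then show ?case using fourier_null_add[OF add.IH(1)[OF add.prems] add.IH(2)[OF add.prems]]
    by (simp add: algebra_simps)
next
  case (mult f g)
  show ?case using mult.IH(1)[OF mult.IH(2)[OF mult.prems]]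
    by (simp add: mult_ac)
qed

lemma (in prob_space) norm_integral_le_const:
  fixes f :: "'a \<Rightarrow> complex"
  assumes "AE x in M. norm (f x) \<le> C" "0 \<le> C"
  shows "norm (\<integral>x. f x \<partial>M) \<le> C"
proof (cases "integrable M f")
  case True
  have "norm (\<integral>x. f x \<partial>M) \<le> (\<integral>x. norm (f x) \<partial>M)" by simp
  also have "\<dots> \<le> (\<integral>x. C \<partial>M)"
    using True assms by (intro integral_mono_AE) auto
  finally show ?thesis by (simp add: prob_space)
qed (simp add: not_integrable_integral_eq assms)

text \<open>A Borel inverse of \<open>torus_emb\<close> on the cube: the argument in \<open>[0, 2\<pi>)\<close>, written through the
  principal logarithm of \<open>- z\<close>, whose imaginary part lies in \<open>(-\<pi>, \<pi>]\<close>. The value at \<open>1\<close> is set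
  separately, because there the formula would give the excluded endpoint.\<close>

definition torus_inv :: "complex^'d \<Rightarrow> real^'d" where
  "torus_inv z = (\<chi> i. if z $ i = 1 then 0 else (Im (Ln (- (z $ i))) + pi) / (2 * pi))"

lemma torus_inv_torus_emb:
  fixes r :: "real^'d"
  assumes "r \<in> cube"
  shows "torus_inv (torus_emb r) = r"
proof -
  have *: "(if cis (2 * pi * x) = 1 then 0 else (Im (Ln (- cis (2 * pi * x))) + pi) / (2 * pi)) = x"
    if x: "0 \<le> x" "x < 1" for x :: real
  proof (cases "x = 0")
    case False
    with x have x: "0 < x" "x < 1" by auto
    have "- cis (2 * pi * x) = exp (\<i> * complex_of_real (2 * pi * x - pi))"
      by (simp only: cis_conv_exp[symmetric]) (simp add: complex_eq_iff cos_diff sin_diff)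
    moreover have "- pi < 2 * pi * x - pi" "2 * pi * x - pi < pi" using x by auto
    ultimately have *: "Im (Ln (- cis (2 * pi * x))) = 2 * pi * x - pi"
      by (simp add: Ln_exp)
    have "cis (2 * pi * x) \<noteq> 1"
    proof
      assume "cis (2 * pi * x) = 1"
      with * have "pi = 2 * pi * x - pi" by simp
      with x show False by simp
    qed
    with * show ?thesis by simp
  qed simp
  show ?thesis
    unfolding vec_eq_iff torus_inv_def torus_emb_def vec_lambda_beta
    using assms by (intro allI *) (auto simp: cube_def)
qed

lemma measurable_torus_inv [measurable]: "torus_inv \<in> borel \<rightarrow>\<^sub>M (borel :: (real^'d) measure)"
proof (rule borel_measurable_euclidean_space[THEN iffD2], intro ballI)
  fix b :: "real^'d" assume "b \<in> Basis"
  then obtain i where b: "b = axis i 1" by (auto simp: Basis_vec_def)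
  have [measurable]: "(\<lambda>z::complex^'d. z $ i) \<in> borel_measurable borel"
    by (intro borel_measurable_continuous_onI continuous_intros)
  have "(\<lambda>z::complex^'d. if z $ i = 1 then 0 else (Im (Ln (- (z $ i))) + pi) / (2 * pi)) \<in> borel_measurable borel"
    by measurable
  then show "(\<lambda>x::complex^'d. torus_inv x \<bullet> b) \<in> borel_measurable borel"
    by (simp add: b inner_axis torus_inv_def)
qed

lemma continuous_torus_emb: "continuous_on S torus_emb"
  unfolding torus_emb_def cis_conv_exp by (intro continuous_intros)

lemma measurable_torus_emb [measurable]: "torus_emb \<in> borel_measurable borel"
  by (intro borel_measurable_continuous_onI continuous_torus_emb)

text \<open>Continuous functions are uniform limits of polynomials on the compact torus, and the integral
  against \<open>h\<close> is continuous for uniform convergence because \<open>h\<close> is bounded.\<close>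

lemma fourier_null_continuous:
  fixes h :: "real^'d \<Rightarrow> complex" and f :: "complex^'d \<Rightarrow> real"
  assumes h: "fourier_null h" and f: "continuous_on UNIV f"
  shows "(\<integral>r. complex_of_real (f (torus_emb r)) * h r \<partial>unit_cube) = 0"
proof (rule ccontr)
  interpret prob_space "unit_cube :: (real^'d) measure" by (rule prob_space_unit_cube)
  obtain B0 where B0: "AE r in unit_cube. norm (h r) \<le> B0" and [measurable]: "h \<in> borel_measurable unit_cube"
    using h by (auto simp: fourier_null_def)
  define B where "B = \<bar>B0\<bar> + 1"
  have B: "AE r in unit_cube. norm (h r) \<le> B" and "B > 0" using B0 by (auto simp: B_def elim!: eventually_mono)
  let ?I = "\<lambda>f. (\<integral>r. complex_of_real (f (torus_emb r)) * h r \<partial>unit_cube)"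
  assume "?I f \<noteq> 0"
  define \<epsilon> where "\<epsilon> = norm (?I f) / (2 * B)"
  have "\<epsilon> > 0" using \<open>?I f \<noteq> 0\<close> \<open>B > 0\<close> by (simp add: \<epsilon>_def)
  define K where "K = torus_emb ` cbox (0::real^'d) 1"
  have K: "compact K" unfolding K_def by (intro compact_continuous_image continuous_torus_emb compact_cbox)
  have inK: "torus_emb r \<in> K" if "r \<in> cube" for r
    using that by (auto simp: K_def cube_def mem_box_cart less_imp_le)
  have "\<exists>p. real_polynomial_function p \<and> (\<forall>z\<in>K. \<bar>f z - p z\<bar> < \<epsilon>)"
    by (rule Stone_Weierstrass_real_polynomial_function[OF K continuous_on_subset[OF f subset_UNIV] \<open>\<epsilon> > 0\<close>])
      (intro exI conjI ballI)
  then obtain p where p: "real_polynomial_function p" and fp: "\<forall>z\<in>K. \<bar>f z - p z\<bar> < \<epsilon>"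
    by (elim exE conjE)
  have cube: "AE r in unit_cube. (r::real^'d) \<in> cube" using AE_space[of "unit_cube :: (real^'d) measure"] by simp
  have np: "fourier_null (\<lambda>r. complex_of_real (p (torus_emb r)) * h r)"
    by (rule fourier_null_polynomial[OF p h])
  have "(\<integral>r. character (real_vec 0) r * (complex_of_real (p (torus_emb r)) * h r) \<partial>unit_cube) = 0"
    using np unfolding fourier_null_def by blast
  moreover have "real_vec 0 = (0 :: real^'d)" by (simp add: real_vec_def vec_eq_iff)
  ultimately have Ip: "?I p = 0" by simp
  from fourier_null_integrable[OF np, of 0] have ip: "integrable unit_cube (\<lambda>r. complex_of_real (p (torus_emb r)) * h r)"
    by simp
  have le: "AE r in unit_cube. norm (complex_of_real (f (torus_emb r) - p (torus_emb r)) * h r) \<le> \<epsilon> * B"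
    using B cube
  proof eventually_elim
    case (elim r)
    then have "\<bar>f (torus_emb r) - p (torus_emb r)\<bar> \<le> \<epsilon>" using fp inK less_imp_le by metis
    then show ?case using elim \<open>\<epsilon> > 0\<close> by (simp only: norm_mult norm_of_real) (rule mult_mono, auto)
  qed
  have "continuous_on UNIV p"
    using continuous_real_polymonial_function[OF p] by (simp add: continuous_on_eq_continuous_at)
  then have [measurable]: "p \<in> borel_measurable borel" "f \<in> borel_measurable borel"
    "torus_emb \<in> borel_measurable (unit_cube :: (real^'d) measure)"
    using f by (simp_all add: borel_measurable_continuous_onI measurable_unit_cube_borel)
  have id: "integrable unit_cube (\<lambda>r. complex_of_real (f (torus_emb r) - p (torus_emb r)) * h r)"
    by (rule integrable_unit_cube_bounded[OF _ le]) measurable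
  have "?I f = (\<integral>r. (complex_of_real (p (torus_emb r)) * h r) + (complex_of_real (f (torus_emb r) - p (torus_emb r)) * h r) \<partial>unit_cube)"
    by (intro Bochner_Integration.integral_cong refl) (simp add: algebra_simps)
  also have "\<dots> = (\<integral>r. complex_of_real (f (torus_emb r) - p (torus_emb r)) * h r \<partial>unit_cube)"
    using Ip by (simp add: Bochner_Integration.integral_add[OF ip id] del: of_real_diff)
  finally have "norm (?I f) \<le> \<epsilon> * B"
    using norm_integral_le_const[OF le] \<open>\<epsilon> > 0\<close> \<open>B > 0\<close> by simp
  then show False using \<open>B > 0\<close> \<open>?I f \<noteq> 0\<close> by (simp add: \<epsilon>_def)
qed

text \<open>The indicator of an open set is the limit of an increasing sequence of continuous functions.\<close>

lemma fourier_null_open: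
  fixes h :: "real^'d \<Rightarrow> complex" and U :: "(complex^'d) set"
  assumes h: "fourier_null h" and U: "open U"
  shows "(\<integral>r. complex_of_real (indicator U (torus_emb r)) * h r \<partial>unit_cube) = 0"
proof (cases "U = UNIV")
  case True
  then show ?thesis using fourier_null_continuous[OF h, of "\<lambda>_. 1"] by simp
next
  case False
  interpret prob_space "unit_cube :: (real^'d) measure" by (rule prob_space_unit_cube)
  obtain B where B: "AE r in unit_cube. norm (h r) \<le> B" and [measurable]: "h \<in> borel_measurable unit_cube"
    using h by (auto simp: fourier_null_def)
  have [measurable]: "torus_emb \<in> borel_measurable unit_cube" by (simp add: measurable_unit_cube_borel)
  have [measurable]: "U \<in> sets borel" using U by simp
  define f where "f n z = min 1 (real n * infdist z (- U))" for n z
  have cont: "continuous_on UNIV (f n)" for n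
    unfolding f_def by (intro continuous_intros)
  have [measurable]: "f n \<in> borel_measurable borel" for n using cont by (rule borel_measurable_continuous_onI)
  have lim: "(\<lambda>n. f n z) \<longlonglongrightarrow> indicator U z" for z
  proof (cases "z \<in> U")
    case True
    then have "infdist z (- U) > 0"
      using in_closed_iff_infdist_zero[of "-U" z] U False infdist_nonneg[of z "-U"]
      by (auto simp: less_le)
    then obtain N where N: "1 < real N * infdist z (- U)" using reals_Archimedean3 by blast
    have "f n z = 1" if "n \<ge> N" for n
    proof -
      have "real N * infdist z (- U) \<le> real n * infdist z (- U)"
        using that by (intro mult_right_mono infdist_nonneg) auto
      with N show ?thesis by (simp add: f_def)
    qed
    then have "eventually (\<lambda>n. f n z = 1) sequentially" by (auto simp: eventually_sequentially)
    then show ?thesis using True by (simp add: tendsto_eventually)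
  next
    case False
    then have "infdist z (- U) = 0" by simp
    then show ?thesis using False by (simp add: f_def)
  qed
  have "(\<lambda>n. \<integral>r. complex_of_real (f n (torus_emb r)) * h r \<partial>unit_cube) \<longlonglongrightarrow>
      (\<integral>r. complex_of_real (indicator U (torus_emb r)) * h r \<partial>unit_cube)"
  proof (rule integral_dominated_convergence[where w="\<lambda>_. B"])
    show "AE r in unit_cube. (\<lambda>n. complex_of_real (f n (torus_emb r)) * h r)
            \<longlonglongrightarrow> complex_of_real (indicator U (torus_emb r)) * h r"
      by (intro AE_I2 tendsto_intros lim)
    show "AE r in unit_cube. norm (complex_of_real (f n (torus_emb r)) * h r) \<le> B" for n
      using B
    proof eventually_elim
      case (elim r)
      have "\<bar>f n (torus_emb r)\<bar> * norm (h r) \<le> 1 * B"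
        using elim by (intro mult_mono) (auto simp: f_def infdist_nonneg)
      then show ?case by (simp add: norm_mult)
    qed
  qed measurable
  then have "(\<lambda>n. 0) \<longlonglongrightarrow> (\<integral>r. complex_of_real (indicator U (torus_emb r)) * h r \<partial>unit_cube)"
    by (simp add: fourier_null_continuous[OF h cont])
  then show ?thesis by (simp add: LIMSEQ_const_iff)
qed

text \<open>The integral of \<open>h\<close> vanishes over preimages of open sets, hence by a Dynkin argument over
  preimages of Borel sets of \<open>\<complex>\<^sup>d\<close>. As \<open>torus_emb\<close> has a Borel inverse, these are all
  measurable subsets of the cube, so \<open>h\<close> is a density of the zero measure.\<close>

lemma fourier_null_imp_zero:
  fixes h :: "real^'d \<Rightarrow> complex"
  assumes h: "fourier_null h"
  shows "AE r in unit_cube. h r = 0"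
proof -
  interpret prob_space "unit_cube :: (real^'d) measure" by (rule prob_space_unit_cube)
  have ih: "integrable unit_cube h" using fourier_null_integrable[OF h, of 0] by simp
  have te [measurable]: "torus_emb \<in> unit_cube \<rightarrow>\<^sub>M borel" by (simp add: measurable_unit_cube_borel)
  let ?e = "\<lambda>A. torus_emb -` A \<inter> cube"
  have se: "?e A \<in> sets unit_cube" if "A \<in> sets borel" for A
    using measurable_sets[OF te that] by simp
  have si: "set_integrable unit_cube (?e A) h" if "A \<in> sets borel" for A
    using se[OF that] ih by (simp add: set_integrable_def integrable_mult_indicator)
  have borel: "(LINT r:?e A|unit_cube. h r) = 0" if "A \<in> sets borel" for A
  proof -
    have "Int_stable {U :: (complex^'d) set. open U}" by (auto simp: Int_stable_def)
    moreover have "{U :: (complex^'d) set. open U} \<subseteq> Pow UNIV" by simp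
    moreover have "A \<in> sigma_sets UNIV {U. open U}" using that by (simp add: borel_def)
    ultimately show ?thesis
    proof (induct rule: sigma_sets_induct_disjoint)
      case (basic U)
      have "(LINT r:?e U|unit_cube. h r) = (\<integral>r. complex_of_real (indicator U (torus_emb r)) * h r \<partial>unit_cube)"
        unfolding set_lebesgue_integral_def
        by (intro Bochner_Integration.integral_cong refl) (auto simp: indicator_def)
      then show ?case using fourier_null_open[OF h] basic by simp
    next
      case empty
      then show ?case by (simp add: set_lebesgue_integral_def)
    next
      case (compl A)
      then have A: "A \<in> sets borel" by (simp add: borel_def)
      have "(LINT r:?e UNIV|unit_cube. h r) = (LINT r:(?e A \<union> ?e (UNIV - A))|unit_cube. h r)"
        by (rule arg_cong[where f="\<lambda>A. set_lebesgue_integral unit_cube A h"]) auto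
      also have "\<dots> = (LINT r:?e A|unit_cube. h r) + (LINT r:?e (UNIV - A)|unit_cube. h r)"
        using A by (intro set_integral_Un si) auto
      moreover have "(LINT r:?e UNIV|unit_cube. h r) = (\<integral>r. complex_of_real (indicator UNIV (torus_emb r)) * h r \<partial>unit_cube)"
        unfolding set_lebesgue_integral_def
        by (intro Bochner_Integration.integral_cong refl) (auto simp: indicator_def)
      ultimately show ?case using compl fourier_null_open[OF h, of UNIV] by simp
    next
      case (union A)
      then have A: "A i \<in> sets borel" for i by (auto simp: borel_def)
      have "(LINT r:?e (\<Union>i. A i)|unit_cube. h r) = (LINT r:(\<Union>i. ?e (A i))|unit_cube. h r)"
        by (rule arg_cong[where f="\<lambda>A. set_lebesgue_integral unit_cube A h"]) auto
      also have "\<dots> = (\<Sum>i. (LINT r:?e (A i)|unit_cube. h r))"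
      proof (rule lebesgue_integral_countable_add)
        show "?e (A i) \<inter> ?e (A j) = {}" if "i \<noteq> j" for i j
          using union(1) that by (auto simp: disjoint_family_on_def)
        have "(\<Union>i. ?e (A i)) = ?e (\<Union>i. A i)" by auto
        then show "set_integrable unit_cube (\<Union>i. ?e (A i)) h"
          using si[of "\<Union>i. A i"] A by auto
      qed (use se A in auto)
      also have "\<dots> = 0" using union(3) by simp
      finally show ?case .
    qed
  qed
  show ?thesis
  proof (rule density_zero[OF ih])
    fix A :: "(real^'d) set" assume "A \<in> sets unit_cube"
    then have A [measurable]: "A \<in> sets borel" "A \<subseteq> cube" by (auto simp: sets_unit_cube_iff)
    have "?e (torus_inv -` A) = A" using A(2) by (auto simp: torus_inv_torus_emb)
    moreover have "torus_inv -` A \<in> sets borel"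
      using measurable_sets[OF measurable_torus_inv A(1)] by simp
    ultimately show "(LINT r:A|unit_cube. h r) = 0" using borel by metis
  qed
qed

section \<open>Almost everywhere statements on a completed product\<close>

lemma (in pair_sigma_finite) AE_pair_fibrewise:
  assumes "AE y in M1 \<Otimes>\<^sub>M M2. Q y"
  shows "AE r in M2. AE x in M1. Q (x, r)"
proof -
  interpret Q: pair_sigma_finite M2 M1 ..
  have "AE y in distr (M2 \<Otimes>\<^sub>M M1) (M1 \<Otimes>\<^sub>M M2) (\<lambda>(x, y). (y, x)). Q y"
    by (subst distr_pair_swap[symmetric]) (rule assms)
  from AE_distrD[OF measurable_pair_swap' this]
  have "AE y in M2 \<Otimes>\<^sub>M M1. Q (case y of (x, y) \<Rightarrow> (y, x))" .
  from Q.AE_pair[OF this] show ?thesis by simp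
qed

text \<open>Fubini's theorem for null sets of the completion, in the direction in which measurability matters.
  A set of the completion is a measurable set up to part of a null set, and almost every section of
  that null set is again null.\<close>

lemma (in pair_sigma_finite) AE_pair_fibrewiseI:
  assumes Q: "{y \<in> space (M1 \<Otimes>\<^sub>M M2). Q y} \<in> sets (completion (M1 \<Otimes>\<^sub>M M2))"
    and ae: "AE r in M2. AE x in M1. Q (x, r)"
  shows "AE y in M1 \<Otimes>\<^sub>M M2. Q y"
proof -
  let ?P = "M1 \<Otimes>\<^sub>M M2"
  obtain A N N' where A: "{y \<in> space ?P. Q y} = A \<union> N" "N \<subseteq> N'" "N' \<in> null_sets ?P" "A \<in> sets ?P"
    using Q by (rule sets_completionE)
  have "AE r in M2. AE x in M1. (x, r) \<notin> N'"
    using AE_pair_fibrewise[OF AE_not_in[OF A(3)]] .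
  then have "AE r in M2. AE x in M1. (x, r) \<in> A"
    using ae AE_space
  proof eventually_elim
    case (elim r)
    from elim(1,2) AE_space show ?case
    proof eventually_elim
      case (elim x)
      then have "(x, r) \<in> {y \<in> space ?P. Q y}" using \<open>r \<in> space M2\<close> by (simp add: space_pair_measure)
      then show ?case using A(1,2) elim by blast
    qed
  qed
  moreover have "{y \<in> space ?P. y \<in> A} = A" using sets.sets_into_space[OF A(4)] by blast
  then have As: "{y \<in> space ?P. y \<in> A} \<in> sets ?P" "{y \<in> space ?P. (fst y, snd y) \<in> A} \<in> sets ?P"
    using A(4) by simp_all
  ultimately have "AE x in M1. AE r in M2. (x, r) \<in> A"
    by (subst AE_commute)
  from AE_pair_measure[OF As(1) this] have "AE y in ?P. y \<in> A" .
  then show ?thesis by (rule eventually_mono) (use A(1) in blast)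
qed

lemma completion_ex_borel_measurable_complex:
  fixes g :: "'a \<Rightarrow> complex"
  assumes "g \<in> borel_measurable (completion M)"
  shows "\<exists>g'\<in>borel_measurable M. AE x in M. g x = g' x"
proof -
  have "(\<lambda>x. Re (g x)) \<in> borel_measurable (completion M)" "(\<lambda>x. Im (g x)) \<in> borel_measurable (completion M)"
    using assms by simp_all
  from this[THEN completion_ex_borel_measurable_real]
  obtain u v where u: "u \<in> borel_measurable M" "AE x in M. Re (g x) = u x"
    and v: "v \<in> borel_measurable M" "AE x in M. Im (g x) = v x"
    by (elim bexE)
  have "AE x in M. g x = Complex (u x) (v x)"
    using u(2) v(2) by eventually_elim (simp add: complex_eq_iff)
  moreover have "(\<lambda>x. Complex (u x) (v x)) \<in> borel_measurable M"
    using u(1) v(1) by (simp add: borel_measurable_complex_iff)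
  ultimately show ?thesis by (intro bexI)
qed

lemma AE_lborel_scaleR:
  fixes c :: real
  assumes c: "c \<noteq> 0" and ae: "AE t::'b::euclidean_space in lborel. Q t"
  shows "AE t in lborel. Q (c *\<^sub>R t)"
proof -
  have "AE t in density (distr lborel borel (\<lambda>x::'b. 0 + c *\<^sub>R x)) (\<lambda>_. ennreal (\<bar>c\<bar>^DIM('b))). Q t"
    using ae by (simp only: lborel_affine[OF c, of 0, symmetric])
  then have "AE t in distr lborel borel (\<lambda>x::'b. 0 + c *\<^sub>R x). Q t"
    using c by (simp add: AE_density)
  from AE_distrD[OF _ this] have "AE t in lborel. Q (0 + c *\<^sub>R t)"
    by simp
  then show ?thesis by simp
qed

lemma AE_unit_cube: "AE t in lborel. Q t \<Longrightarrow> AE t in unit_cube. Q t"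
  unfolding unit_cube_eq by (subst AE_restrict_space_iff) (simp_all add: eventually_mono)

lemma AE_rotation:
  assumes "AE r in unit_cube. Q r"
  shows "AE r in unit_cube. Q (vec_frac (t + r))"
  by (rule AE_distrD[OF measurable_rotation]) (simp only: distr_rotation assms)

section \<open>The conjugacy with the product action\<close>

locale embedded_action =
  fixes M :: "'a measure"
    and T :: "int^'d \<Rightarrow> 'a \<Rightarrow> 'a"
    and S :: "real^'d \<Rightarrow> 'a \<Rightarrow> 'a"
  assumes prob: "prob_space M" and T: "mp_action M T" and embedding: "embedding M T S"
begin

sublocale base: prob_space M by (rule prob)
sublocale cube: prob_space "unit_cube :: (real^'d) measure" by (rule prob_space_unit_cube)
sublocale P: pair_prob_space M "unit_cube :: (real^'d) measure" ..

abbreviation "P \<equiv> M \<Otimes>\<^sub>M (unit_cube :: (real^'d) measure)"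

lemma S: "mp_action M S"
  and joint_measurable: "(\<lambda>(t, x). S t x) \<in> completion (lborel \<Otimes>\<^sub>M M) \<rightarrow>\<^sub>M M"
  using embedding by (auto simp: embedding_def Rd_action_def)

lemma measurable_S [measurable]: "S t \<in> M \<rightarrow>\<^sub>M M" and distr_S: "distr M M (S t) = M"
  using S by (auto simp: mp_action_def measure_preserving_map_def)

lemma measurable_T [measurable]: "T n \<in> M \<rightarrow>\<^sub>M M"
  using T by (auto simp: mp_action_def measure_preserving_map_def)

lemma S_0: "x \<in> space M \<Longrightarrow> S 0 x = x" and S_add: "x \<in> space M \<Longrightarrow> S (s + t) x = S s (S t x)"
  using S by (auto simp: mp_action_def)

lemma AE_S:
  assumes "AE x in M. Q x"
  shows "AE x in M. Q (S t x)"
  by (rule AE_distrD[OF measurable_S]) (simp only: distr_S assms)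

lemma AE_S_eq_T: "AE x in M. \<forall>n. S (real_vec n) x = T n x"
  using embedding by (simp add: embedding_def AE_all_countable)

text \<open>The map \<open>(x, r) \<mapsto> (c r, x)\<close> pulls null sets back to null sets, so it remains measurable after
  both sides are completed and can be composed with the jointly measurable action. The cases
  \<open>c = 1\<close> and \<open>c = -1\<close> are the conjugacy between the suspension and the product action and its
  inverse.\<close>

lemma measurable_shear:
  fixes c :: real
  assumes c: "c \<noteq> 0"
  shows "(\<lambda>(x, r). S (c *\<^sub>R r) x) \<in> completion P \<rightarrow>\<^sub>M M"
proof -
  interpret lM: pair_sigma_finite lborel M ..
  let ?j = "\<lambda>(x :: 'a, r :: real^'d). (c *\<^sub>R r, x)"
  have j: "?j \<in> P \<rightarrow>\<^sub>M lborel \<Otimes>\<^sub>M M"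
  proof -
    have "(\<lambda>r. c *\<^sub>R r) \<in> unit_cube \<rightarrow>\<^sub>M (lborel :: (real^'d) measure)"
      by (rule measurable_unit_cube_borel) simp
    then show ?thesis by measurable
  qed
  have null: "?j -` N \<inter> space P \<in> null_sets P" if N: "N \<in> null_sets (lborel \<Otimes>\<^sub>M M)" for N
  proof -
    have "AE t in lborel. AE x in M. (t, x) \<notin> N"
      using lM.AE_pair[OF AE_not_in[OF N]] .
    then have "AE r in unit_cube. AE x in M. (c *\<^sub>R r, x) \<notin> N"
      by (intro AE_unit_cube AE_lborel_scaleR[OF c, of "\<lambda>t. AE x in M. (t, x) \<notin> N"])
    moreover have m: "?j -` N \<inter> space P \<in> sets P" using N by (intro measurable_sets[OF j]) auto
    moreover have "{y \<in> space P. ?j y \<notin> N} = space P - (?j -` N \<inter> space P)" by blast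
    then have "{y \<in> space P. ?j y \<notin> N} \<in> sets (completion P)"
      using m by (simp only: sets_completionI_sets sets.Diff sets.top)
    ultimately have "AE y in P. ?j y \<notin> N"
      by (intro P.AE_pair_fibrewiseI) simp_all
    then have "AE y in P. y \<notin> ?j -` N \<inter> space P"
      by (rule eventually_mono) blast
    then show ?thesis using m by (simp add: AE_iff_null_sets)
  qed
  have "?j \<in> completion P \<rightarrow>\<^sub>M completion (lborel \<Otimes>\<^sub>M M)"
  proof (rule completion.measurable_completion2[OF measurable_completion[OF j] subsetI])
    fix N :: "((real^'d) \<times> 'a) set" assume N: "N \<in> null_sets (lborel \<Otimes>\<^sub>M M)"
    have "?j -` N \<inter> space (completion P) \<in> null_sets (completion P)"
      using null_sets_completionI[OF null[OF N]] by (simp only: space_completion)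
    then show "N \<in> null_sets (distr (completion P) (lborel \<Otimes>\<^sub>M M) ?j)"
      using null_setsD2[OF N] by (simp only: null_sets_distr_iff[OF measurable_completion[OF j]])
  qed
  from measurable_compose[OF this joint_measurable]
  show ?thesis by (simp add: case_prod_unfold)
qed

lemma measurable_suspension: "suspension T t \<in> P \<rightarrow>\<^sub>M P"
proof -
  have snd: "snd \<in> P \<rightarrow>\<^sub>M unit_cube" and fst: "fst \<in> P \<rightarrow>\<^sub>M M" by simp_all
  have "(\<lambda>r. vec_floor (t + r)) \<in> unit_cube \<rightarrow>\<^sub>M count_space UNIV"
    by (rule measurable_unit_cube_borel) measurable
  from measurable_compose[OF snd this]
  have fl: "(\<lambda>y. vec_floor (t + snd y)) \<in> P \<rightarrow>\<^sub>M count_space UNIV" .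
  have fr: "(\<lambda>y. vec_frac (t + snd y)) \<in> P \<rightarrow>\<^sub>M unit_cube"
    by (rule measurable_compose[OF snd measurable_rotation])
  have "(\<lambda>y. T n (fst y)) \<in> P \<rightarrow>\<^sub>M M" for n
    by (rule measurable_compose[OF fst measurable_T])
  from measurable_Pair[OF measurable_compose_countable[OF this fl] fr]
  show ?thesis by (simp add: suspension_def case_prod_unfold)
qed

text \<open>On a fibre over \<open>r\<close> the suspension applies a single integer element of \<open>T\<close>, which agrees almost
  everywhere with \<open>S\<close>. There are countably many of these elements, so one null set serves all \<open>r\<close>.\<close>

lemma AE_suspension_iff:
  assumes F: "F \<in> borel_measurable P"
  shows "(AE y in P. F (suspension T t y) = (c::complex) * F y) \<longleftrightarrow>
    (AE r in unit_cube. AE x in M. F (S (real_vec (vec_floor (t + r))) x, vec_frac (t + r)) = c * F (x, r))"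
    (is "?L \<longleftrightarrow> ?R")
proof -
  have eq: "(AE x in M. F (S (real_vec (vec_floor (t + r))) x, vec_frac (t + r)) = c * F (x, r))
    \<longleftrightarrow> (AE x in M. F (suspension T t (x, r)) = c * F (x, r))" for r
  proof (rule eventually_cong[OF AE_S_eq_T])
    fix x assume "\<forall>n. S (real_vec n) x = T n x"
    then show "(F (S (real_vec (vec_floor (t + r))) x, vec_frac (t + r)) = c * F (x, r))
      \<longleftrightarrow> (F (suspension T t (x, r)) = c * F (x, r))"
      by (simp add: suspension_def)
  qed
  have "(\<lambda>y. F (suspension T t y)) \<in> borel_measurable P"
    by (rule measurable_compose[OF measurable_suspension F])
  with F have "{y \<in> space P. F (suspension T t y) = c * F y} \<in> sets P"
    by measurable
  then have "{y \<in> space P. F (suspension T t y) = c * F y} \<in> sets (completion P)"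
    by (rule sets_completionI_sets)
  note I = P.AE_pair_fibrewiseI[OF this]
  show ?thesis
    unfolding eq by (rule iffI, erule P.AE_pair_fibrewise, erule I)
qed

lemma integral_S:
  fixes f :: "'a \<Rightarrow> complex"
  assumes "f \<in> borel_measurable M"
  shows "(\<integral>x. f (S t x) \<partial>M) = (\<integral>x. f x \<partial>M)"
  using integral_distr[OF measurable_S assms, of t] by (simp only: distr_S)

text \<open>The conjugacy: after the shear by \<open>S r\<close> the suspension becomes \<open>S t\<close> in the first coordinate.\<close>

lemma floor_plus_frac_S:
  assumes "x \<in> space M"
  shows "S (vec_frac (t + r)) (S (real_vec (vec_floor (t + r))) x) = S t (S r x)"
  using assms by (simp only: S_add[symmetric] vec_floor_plus_frac add.commute[of "vec_frac _"])

section \<open>Eigenfunctions of the flow give eigenfunctions of the suspension\<close>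

text \<open>The eigenfunction is \<open>f(S r x)\<close>, replaced by an almost everywhere equal function that is measurable
  for the uncompleted product. Orthogonality to a function \<open>g\<close> of \<open>r\<close> follows by integrating over \<open>x\<close>
  first, because \<open>S r\<close> preserves the integral and \<open>f\<close> has mean zero.\<close>

lemma ex_suspension_eigenfunction:
  assumes f [measurable]: "f \<in> borel_measurable M" and bound: "\<And>x. norm (f x) \<le> B"
    and mean: "(\<integral>x. f x \<partial>M) = 0" and nz: "\<not> (AE x in M. f x = 0)" and l: "l \<in> L"
    and eigen: "\<And>t. t \<in> L \<Longrightarrow> AE x in M. f (S t x) = character l t * f x"
  shows "\<exists>F\<in>L2_O M. eigenfunction_on L (susp_measure M) (suspension T) l F"
proof -
  have "(\<lambda>y. f (S (1 *\<^sub>R snd y) (fst y))) \<in> borel_measurable (completion P)"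
    using measurable_compose[OF measurable_shear f, of 1] by (simp add: case_prod_unfold)
  from completion_ex_borel_measurable_complex[OF this]
  obtain F where F [measurable]: "F \<in> borel_measurable P" and FF: "AE y in P. f (S (1 *\<^sub>R snd y) (fst y)) = F y"
    by (elim bexE)
  have F_eq: "AE r in unit_cube. AE x in M. F (x, r) = f (S r x)"
    using P.AE_pair_fibrewise[OF FF] by (simp add: eq_commute)
  have F_bound: "AE y in P. norm (F y) \<le> B"
    using FF by eventually_elim (use bound in metis)
  have "F \<in> L2 P"
  proof -
    have "AE y in P. norm ((norm (F y))\<^sup>2) \<le> B\<^sup>2"
      using F_bound by eventually_elim (simp add: power_mono)
    then have "integrable P (\<lambda>y. (norm (F y))\<^sup>2)"
      by (intro P.integrable_const_bound) auto
    then show ?thesis by (simp add: L2_def F)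
  qed
  moreover have "(\<integral>y. F y * cnj (g (snd y)) \<partial>P) = 0" for g
  proof (cases "integrable P (\<lambda>y. F y * cnj (g (snd y)))")
    case True
    have "AE r in unit_cube. (\<integral>x. F (x, r) * cnj (g r) \<partial>M) = 0"
      using F_eq AE_space
    proof eventually_elim
      case (elim r)
      have [measurable]: "(\<lambda>x. F (x, r)) \<in> borel_measurable M"
        by (rule measurable_compose[OF measurable_Pair2'[OF elim(2)] F])
      have "(\<integral>x. F (x, r) * cnj (g r) \<partial>M) = (\<integral>x. f (S r x) * cnj (g r) \<partial>M)"
      proof (rule integral_cong_AE)
        show "AE x in M. F (x, r) * cnj (g r) = f (S r x) * cnj (g r)"
          using elim(1) by (rule eventually_mono) simp
      qed measurable
      also have "\<dots> = 0" using mean by (simp add: integral_S)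
      finally show ?case .
    qed
    then have "(\<integral>r. (\<integral>x. F (x, r) * cnj (g r) \<partial>M) \<partial>unit_cube) = 0"
      by (rule integral_eq_zero_AE)
    then show ?thesis
      using P.integral_snd[of "\<lambda>x r. F (x, r) * cnj (g r)"] True by (simp add: case_prod_unfold)
  \<comment> \<open>A product that is not integrable has integral zero by convention.\<close>
  qed (rule not_integrable_integral_eq)
  ultimately have "F \<in> L2_O M"
    by (auto simp: L2_O_def fibre_functions_def susp_measure_def case_prod_unfold)
  moreover have "\<not> (AE y in P. F y = 0)"
  proof
    assume "AE y in P. F y = 0"
    from P.AE_pair_fibrewise[OF this] F_eq
    have "AE r in unit_cube. AE x in M. f (S r x) = 0"
    proof eventually_elim
      case (elim r)
      then show ?case by eventually_elim simp
    qed
    from eventually_happens'[OF cube.ae_filter_bot this] obtain r where "AE x in M. f (S r x) = 0"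
      by (elim exE)
    from AE_S[OF this, of "- r"] AE_space have "AE x in M. f x = 0"
      by eventually_elim (simp add: S_add[symmetric] S_0)
    with nz show False ..
  qed
  moreover have "AE y in P. F (suspension T t y) = character l t * F y" if t: "t \<in> L" for t
  proof (subst AE_suspension_iff[OF F])
    from F_eq AE_rotation[OF F_eq, of t]
    show "AE r in unit_cube. AE x in M.
       F (S (real_vec (vec_floor (t + r))) x, vec_frac (t + r)) = character l t * F (x, r)"
    proof eventually_elim
      case (elim r)
      from elim(1) AE_S[OF elim(2), of "real_vec (vec_floor (t + r))"] AE_S[OF eigen[OF t], of r] AE_space
      show ?case
        by eventually_elim (simp add: floor_plus_frac_S)
    qed
  qed
  ultimately show ?thesis using l
    by (intro bexI[of _ F]) (auto simp: eigenfunction_on_def susp_measure_def L2_O_def)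
qed

end

section \<open>Eigenfunctions of the suspension over a weak mixing flow\<close>

text \<open>Take the orthogonal projection of \<open>k\<close> to \<open>L\<close>.\<close>

lemma ex_character_on_subspace:
  assumes "subspace L"
  obtains l where "l \<in> L" "\<And>t. t \<in> L \<Longrightarrow> character l t = character k t"
proof -
  obtain y z where y: "y \<in> span L" and z: "\<And>w. w \<in> span L \<Longrightarrow> orthogonal z w" and k: "k = y + z"
    using orthogonal_subspace_decomp_exists[of L k] by metis
  have sp: "span L = L" using assms by (simp only: span_eq_iff)
  have "character y t = character k t" if "t \<in> L" for t
    using z[of t] that by (simp add: character_def k inner_add_left orthogonal_def sp)
  with y show thesis by (intro that[of y]) (simp_all only: sp)
qed

context embedded_action
begin

text \<open>Weak mixing speaks of characters with frequency in \<open>L\<close> and of nonzero eigenfunctions; here the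
  frequency is an arbitrary vector, as it comes out for the Fourier coefficients.\<close>

lemma eigenfunction_constant:
  assumes wm: "weak_mixing_on L M S" and L: "subspace L"
    and f: "f \<in> borel_measurable M" and bound: "\<And>x. norm (f x) \<le> 1"
    and eigen: "\<And>t. t \<in> L \<Longrightarrow> AE x in M. f (S t x) = character k t * f x"
  shows "\<exists>c. AE x in M. f x = c"
proof (cases "AE x in M. f x = 0")
  case True
  then show ?thesis by (rule exI)
next
  case False
  obtain l where l: "l \<in> L" "\<And>t. t \<in> L \<Longrightarrow> character l t = character k t"
    using ex_character_on_subspace[OF L, of k] by metis
  have "(norm (f x))\<^sup>2 \<le> 1" for x
    using bound[of x] by (simp add: power_le_one)
  then have "integrable M (\<lambda>x. (norm (f x))\<^sup>2)"
    using f by (intro base.integrable_const_bound[where B=1]) simp_all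
  with f have "f \<in> L2 M" by (simp add: L2_def)
  with False l eigen have "eigenfunction_on L M S l f"
    by (simp add: eigenfunction_on_def)
  with wm show ?thesis unfolding weak_mixing_on_def by (elim allE impE)
qed

text \<open>In the coordinates of the product action the eigenfunction becomes \<open>G(x, r) = F(S (-r) x, r)\<close>. Its
  Fourier coefficients in \<open>r\<close> are eigenfunctions of \<open>S\<close> on \<open>L\<close>: translating \<open>x\<close> by \<open>S t\<close> amounts,
  up to the eigenvalue, to rotating \<open>r\<close>, and the rotation multiplies the coefficient by a constant.
  Once they are constant, almost all sections \<open>G(x, _)\<close> have the same Fourier coefficients as
  one fixed section and hence agree with it.\<close>

lemma suspension_eigenfunction_fibre:
  assumes wm: "weak_mixing_on L M S" and L: "subspace L"
    and F [measurable]: "F \<in> borel_measurable P" and bound: "\<And>y. norm (F y) \<le> 1"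
    and eigen: "\<And>t. t \<in> L \<Longrightarrow> AE y in P. F (suspension T t y) = character l t * F y"
  shows "\<exists>g\<in>borel_measurable unit_cube. AE y in P. F y = g (snd y)"
proof -
  let ?H = "\<lambda>y. F (S (- 1 *\<^sub>R snd y) (fst y), snd y)"
  have "(\<lambda>y. S (- 1 *\<^sub>R snd y) (fst y)) \<in> completion P \<rightarrow>\<^sub>M M"
    using measurable_shear[of "- 1"] by (simp add: case_prod_unfold)
  moreover have "snd \<in> completion P \<rightarrow>\<^sub>M unit_cube"
    by (rule measurable_completion) simp
  ultimately have "(\<lambda>y. (S (- 1 *\<^sub>R snd y) (fst y), snd y)) \<in> completion P \<rightarrow>\<^sub>M P"
    by (rule measurable_Pair)
  from completion_ex_borel_measurable_complex[OF measurable_compose[OF this F]]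
  obtain G0 where G0 [measurable]: "G0 \<in> borel_measurable P" and HG0: "AE y in P. ?H y = G0 y"
    by (elim bexE)
  \<comment> \<open>Truncation makes the bound hold at every point, so that all sections are integrable.\<close>
  define G where "G y = (if norm (G0 y) \<le> 1 then G0 y else 0)" for y
  have G [measurable]: "G \<in> borel_measurable P" unfolding G_def by measurable
  have G_bound: "norm (G y) \<le> 1" for y by (simp add: G_def)
  have HG: "AE y in P. ?H y = G y"
    using HG0
  proof (rule eventually_mono)
    fix y assume *: "?H y = G0 y"
    then have "norm (G0 y) \<le> 1" using bound by metis
    with * show "?H y = G y" by (simp only: G_def if_True)
  qed
  have G_eq: "AE r in unit_cube. AE x in M. F (S (- r) x, r) = G (x, r)"
    using P.AE_pair_fibrewise[OF HG] by simp
  have G_section: "(\<lambda>r. G (x, r)) \<in> borel_measurable unit_cube" if "x \<in> space M" for x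
    by (rule measurable_compose[OF measurable_Pair1'[OF that] G])
  have G_eigen: "AE x in M. AE r in unit_cube. G (S t x, vec_frac (t + r)) = character l t * G (x, r)"
    if t: "t \<in> L" for t
  proof -
    have "AE r in unit_cube. AE x in M. F (S (real_vec (vec_floor (t + r))) x, vec_frac (t + r)) = character l t * F (x, r)"
      using eigen[OF t] by (simp only: AE_suspension_iff[OF F])
    from this G_eq AE_rotation[OF G_eq, of t]
    have "AE r in unit_cube. AE x in M. G (S t x, vec_frac (t + r)) = character l t * G (x, r)"
    proof eventually_elim
      case (elim r)
      from AE_S[OF elim(1), of "- r"] elim(2) AE_S[OF elim(3), of t] AE_space
      show ?case
      proof eventually_elim
        case (elim x)
        have "real_vec (vec_floor (t + r)) + - r = - vec_frac (t + r) + t"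
          using vec_floor_plus_frac[of "t + r"] by (simp add: algebra_simps)
        then have "S (real_vec (vec_floor (t + r))) (S (- r) x) = S (- vec_frac (t + r)) (S t x)"
          using elim(4) by (simp only: S_add[symmetric])
        with elim(1-3) show ?case by simp
      qed
    qed
    moreover have "{y \<in> space P. G (S t (fst y), vec_frac (t + snd y)) = character l t * G (fst y, snd y)} \<in> sets P"
    proof -
      have "(\<lambda>y. (S t (fst y), vec_frac (t + snd y))) \<in> P \<rightarrow>\<^sub>M P"
        by (intro measurable_Pair measurable_compose[OF measurable_fst measurable_S]
            measurable_compose[OF measurable_snd measurable_rotation])
      from measurable_compose[OF this G]
      have [measurable]: "(\<lambda>y. G (S t (fst y), vec_frac (t + snd y))) \<in> borel_measurable P" .
      show ?thesis unfolding prod.collapse by measurable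
    qed
    ultimately show ?thesis
      by (subst P.AE_commute)
  qed
  define c where "c k x = (\<integral>r. character (real_vec k) r * G (x, r) \<partial>unit_cube)" for k x
  have char [measurable]: "character k \<in> borel_measurable (unit_cube :: (real^'d) measure)" for k
    by (rule measurable_unit_cube_borel) measurable
  have c_measurable: "c k \<in> borel_measurable M" for k
  proof -
    have "(\<lambda>(x, r). character (real_vec k) r * G (x, r)) \<in> borel_measurable P"
      using G measurable_compose[OF measurable_snd char] by (simp add: case_prod_unfold)
    from cube.borel_measurable_lebesgue_integral[OF this]
    show ?thesis by (simp add: c_def[abs_def])
  qed
  have c_bound: "norm (c k x) \<le> 1" for k x
    unfolding c_def by (rule cube.norm_integral_le_const) (simp_all add: norm_mult G_bound)
  have c_eigen: "AE x in M. c k (S t x) = character (real_vec k + l) t * c k x" if t: "t \<in> L" for k t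
    using G_eigen[OF t] AE_space
  proof eventually_elim
    case (elim x)
    have Sx: "S t x \<in> space M" using measurable_space[OF measurable_S elim(2)] .
    have m: "(\<lambda>r. character (real_vec k) r * G (S t x, r)) \<in> borel_measurable unit_cube"
      using G_section[OF Sx] by measurable
    \<comment> \<open>The rotation preserves the measure on the cube.\<close>
    have "c k (S t x) = (\<integral>r. character (real_vec k) (vec_frac (t + r)) * G (S t x, vec_frac (t + r)) \<partial>unit_cube)"
      using integral_distr[OF measurable_rotation m, of t] by (simp only: c_def distr_rotation)
    also have "\<dots> = (\<integral>r. character (real_vec k + l) t * (character (real_vec k) r * G (x, r)) \<partial>unit_cube)"
    proof (rule integral_cong_AE)
      show "(\<lambda>r. character (real_vec k) (vec_frac (t + r)) * G (S t x, vec_frac (t + r))) \<in> borel_measurable unit_cube"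
        by (rule measurable_compose[OF measurable_rotation m])
      show "(\<lambda>r. character (real_vec k + l) t * (character (real_vec k) r * G (x, r))) \<in> borel_measurable unit_cube"
        using G_section[OF elim(2)] by measurable
      show "AE r in unit_cube. character (real_vec k) (vec_frac (t + r)) * G (S t x, vec_frac (t + r))
          = character (real_vec k + l) t * (character (real_vec k) r * G (x, r))"
        using elim(1) by (rule eventually_mono) (simp add: character_vec_frac character_add_left character_add_right)
    qed
    also have "\<dots> = character (real_vec k + l) t * c k x" by (simp add: c_def)
    finally show ?case .
  qed
  have coefficient_integrable: "integrable unit_cube (\<lambda>r. character (real_vec k) r * G (x, r))"
    if "x \<in> space M" for k x
  proof (rule integrable_unit_cube_bounded[where B=1])
    show "(\<lambda>r. character (real_vec k) r * G (x, r)) \<in> borel_measurable unit_cube"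
      using G_section[OF that] by measurable
  qed (simp add: norm_mult G_bound)
  have "\<exists>C. AE x in M. c k x = C" for k
    by (rule eigenfunction_constant[OF wm L c_measurable c_bound c_eigen])
  then obtain C where C: "\<And>k. AE x in M. c k x = C k" by metis
  then have cC: "AE x in M. \<forall>k. c k x = C k" unfolding AE_all_countable by (rule allI)
  have "AE x in M. x \<in> space M \<and> (\<forall>k. c k x = C k)"
    using cC AE_space by eventually_elim simp
  from eventually_happens'[OF base.ae_filter_bot this]
  obtain x0 where x0: "x0 \<in> space M" "\<And>k. c k x0 = C k" by (elim exE conjE) simp
  define g where "g r = G (x0, r)" for r
  have g [measurable]: "g \<in> borel_measurable unit_cube"
    using G_section[OF x0(1)] by (simp only: g_def[abs_def])
  have "AE x in M. AE r in unit_cube. G (x, r) = g r"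
    using cC AE_space
  proof eventually_elim
    case (elim x)
    note [measurable] = G_section[OF elim(2)]
    have "norm (G (x, r) - g r) \<le> 2" for r
      using norm_triangle_ineq4[of "G (x, r)" "g r"] G_bound[of "(x, r)"] G_bound[of "(x0, r)"]
      by (simp add: g_def)
    moreover have "(\<integral>r. character (real_vec k) r * (G (x, r) - g r) \<partial>unit_cube) = 0" for k
    proof -
      note coefficient_integrable[OF elim(2), of k] coefficient_integrable[OF x0(1), of k]
      then have "(\<integral>r. character (real_vec k) r * (G (x, r) - g r) \<partial>unit_cube) = c k x - c k x0"
        by (simp add: c_def g_def right_diff_distrib)
      then show ?thesis using elim(1) x0(2) by simp
    qed
    ultimately have "fourier_null (\<lambda>r. G (x, r) - g r)"
      unfolding fourier_null_def by (intro conjI exI[of _ 2] allI AE_I2) simp_all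
    from fourier_null_imp_zero[OF this] show ?case by simp
  qed
  moreover have gs: "(\<lambda>y. g (snd y)) \<in> borel_measurable P"
    by (rule measurable_compose[OF measurable_snd g])
  then have "{y \<in> space P. G y = g (snd y)} \<in> sets P"
    by measurable
  ultimately have "AE y in P. G y = g (snd y)"
    by (intro P.AE_pair_measure) simp_all
  from P.AE_pair_fibrewise[OF this] G_eq
  have "AE r in unit_cube. AE x in M. F (x, r) = g (snd (x, r))"
  proof eventually_elim
    case (elim r)
    from AE_S[OF elim(1), of r] AE_S[OF elim(2), of r] AE_space show ?case
      by eventually_elim (simp add: S_add[symmetric] S_0)
  qed
  moreover have "{y \<in> space P. F y = g (snd y)} \<in> sets P"
    using gs by measurable
  then have "{y \<in> space P. F y = g (snd y)} \<in> sets (completion P)" by (rule sets_completionI_sets)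
  ultimately have "AE y in P. F y = g (snd y)"
    by (intro P.AE_pair_fibrewiseI)
  with g show ?thesis by (intro bexI)
qed

text \<open>Such an \<open>F\<close> is orthogonal to itself.\<close>

lemma L2_O_fibre_imp_zero:
  assumes F: "F \<in> L2_O M" and h [measurable]: "h \<in> borel_measurable unit_cube"
    and Fh: "AE y in P. F y = h (snd y)"
  shows "AE y in P. F y = 0"
proof -
  have F_measurable [measurable]: "F \<in> borel_measurable P" and F2: "integrable P (\<lambda>y. (norm (F y))\<^sup>2)"
    using F by (simp_all add: L2_O_def L2_def susp_measure_def)
  have hs [measurable]: "(\<lambda>y. h (snd y)) \<in> borel_measurable P"
    by (rule measurable_compose[OF measurable_snd h])
  have "integrable P (\<lambda>y. (norm (h (snd y)))\<^sup>2)"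
  proof (rule integrable_cong_AE_imp[OF F2])
    show "AE y in P. (norm (F y))\<^sup>2 = (norm (h (snd y)))\<^sup>2"
      using Fh by (rule eventually_mono) simp
  qed measurable
  then have "integrable unit_cube (\<lambda>r. \<integral>x. (norm (h r))\<^sup>2 \<partial>M)"
    by (intro P.integrable_snd) (simp add: case_prod_unfold)
  then have "h \<in> L2 unit_cube"
    using h by (simp add: L2_def base.prob_space)
  then have "(\<lambda>(x, s). h s) \<in> fibre_functions"
    unfolding fibre_functions_def by (intro CollectI bexI[of _ h] refl)
  moreover have "\<forall>H\<in>fibre_functions. (\<integral>y. F y * cnj (H y) \<partial>P) = 0"
    using F by (simp add: L2_O_def susp_measure_def)
  ultimately have "(\<integral>y. F y * cnj (case y of (x, s) \<Rightarrow> h s) \<partial>P) = 0"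
    by (rule bspec[rotated])
  moreover have "(\<integral>y. F y * cnj (case y of (x, s) \<Rightarrow> h s) \<partial>P) = (\<integral>y. complex_of_real ((norm (F y))\<^sup>2) \<partial>P)"
  proof (rule integral_cong_AE)
    show "AE y in P. F y * cnj (case y of (x, s) \<Rightarrow> h s) = complex_of_real ((norm (F y))\<^sup>2)"
      using Fh by (rule eventually_mono) (simp add: case_prod_unfold complex_norm_square del: of_real_power)
    have [measurable]: "cnj \<in> borel_measurable borel"
      by (intro borel_measurable_continuous_onI continuous_on_cnj continuous_on_id)
    have "(\<lambda>y. F y * cnj (h (snd y))) \<in> borel_measurable P" by measurable
    then show "(\<lambda>y. F y * cnj (case y of (x, s) \<Rightarrow> h s)) \<in> borel_measurable P"
      by (simp add: case_prod_unfold)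
  qed measurable
  ultimately have "(\<integral>y. (norm (F y))\<^sup>2 \<partial>P) = 0"
    by (simp only: integral_complex_of_real of_real_eq_0_iff)
  then have "AE y in P. (norm (F y))\<^sup>2 = 0"
    using integral_nonneg_eq_0_iff_AE[OF F2] by simp
  then show ?thesis by (rule eventually_mono) simp
qed

end

section \<open>Directional weak mixing and weak mixing of the restricted flow\<close>

text \<open>An injective map into the open unit disc that commutes with multiplication by unimodular numbers.
  Composing with it turns an eigenfunction into a bounded one for the same character.\<close>

definition squash :: "complex \<Rightarrow> complex" where
  "squash z = z / of_real (1 + norm z)"

lemma norm_squash: "norm (squash z) < 1"
proof -
  have "0 < 1 + norm z" by (simp add: add_pos_nonneg)
  then show ?thesis by (simp add: squash_def norm_divide divide_less_eq del: of_real_add)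
qed

lemma unsquash: "squash z / of_real (1 - norm (squash z)) = z"
proof -
  have p: "0 < 1 + norm z" by (simp add: add_pos_nonneg)
  then have "norm (squash z) = norm z / (1 + norm z)"
    by (simp add: squash_def norm_divide del: of_real_add)
  moreover have "1 - norm z / (1 + norm z) = 1 / (1 + norm z)"
    using p by (simp add: field_simps)
  ultimately have "1 - norm (squash z) = 1 / (1 + norm z)" by simp
  moreover from p have "complex_of_real (1 + norm z) \<noteq> 0" by (simp only: of_real_eq_0_iff)
  ultimately show ?thesis by (simp add: squash_def of_real_divide del: of_real_add)
qed

lemma squash_unimodular: "norm c = 1 \<Longrightarrow> squash (c * z) = c * squash z"
  by (simp add: squash_def norm_mult)

lemma measurable_squash [measurable]: "squash \<in> borel_measurable borel"
  unfolding squash_def by measurable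

lemma norm_squash_le: "norm (squash z) \<le> 1"
  using norm_squash[of z] by (rule less_imp_le)

theorem corollary4p16:
  fixes M :: "'a measure"
    and T :: "int^'d \<Rightarrow> 'a \<Rightarrow> 'a"
    and S :: "real^'d \<Rightarrow> 'a \<Rightarrow> 'a"
    and e :: nat
    and L :: "(real^'d) set"
  assumes "lebesgue_probability_space M"
    and "Zd_action M T"
    and "Zd_weak_mixing M T"
    and "embedding M T S"
    and "1 \<le> e" and "e \<le> CARD('d)"
    and "L \<in> grassmannian e"
  shows "directional_weak_mixing L M T \<longleftrightarrow> weak_mixing_on L M S"
proof -
  interpret embedded_action M T S
    using assms(1,2,4) by (intro embedded_action.intro) (simp_all only: lebesgue_probability_space_def Zd_action_def)
  have L: "subspace L" using assms by (simp add: grassmannian_def)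
  show ?thesis
  proof
    assume directional: "directional_weak_mixing L M T"
    show "weak_mixing_on L M S"
      unfolding weak_mixing_on_def
    proof (intro allI impI)
      fix l f assume "eigenfunction_on L M S l f"
      then have l: "l \<in> L" and f [measurable]: "f \<in> borel_measurable M"
        and eigen: "\<And>t. t \<in> L \<Longrightarrow> AE x in M. f (S t x) = character l t * f x"
        by (simp_all add: eigenfunction_on_def L2_def)
      define u where "u x = squash (f x)" for x
      have u [measurable]: "u \<in> borel_measurable M" unfolding u_def by measurable
      have u_integrable: "integrable M u"
        by (rule base.integrable_const_bound[where B=1]) (simp_all add: u_def norm_squash_le u[unfolded u_def])
      have u_eigen: "AE x in M. u (S t x) = character l t * u x" if "t \<in> L" for t
        using eigen[OF that] by (rule eventually_mono) (simp add: u_def squash_unimodular)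
      define m where "m = (\<integral>x. u x \<partial>M)"
      \<comment> \<open>Both sides of the eigenfunction equation have the same mean, so subtracting the mean keeps
        it valid; for a nontrivial character this forces \<open>m = 0\<close>.\<close>
      have m_eigen: "m = character l t * m" if "t \<in> L" for t
      proof -
        have "m = (\<integral>x. u (S t x) \<partial>M)" by (simp only: m_def integral_S[OF u])
        also have "\<dots> = (\<integral>x. character l t * u x \<partial>M)"
          by (rule integral_cong_AE[OF _ _ u_eigen[OF that]]) measurable
        also have "\<dots> = character l t * m" by (simp add: m_def)
        finally show ?thesis .
      qed
      have "AE x in M. u x - m = 0"
      proof (rule ccontr)
        assume nz: "\<not> (AE x in M. u x - m = 0)"
        have "\<exists>F\<in>L2_O M. eigenfunction_on L (susp_measure M) (suspension T) l F"
        proof (rule ex_suspension_eigenfunction[where B="1 + norm m", OF _ _ _ nz l])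
          show "(\<lambda>x. u x - m) \<in> borel_measurable M" by measurable
          show "norm (u x - m) \<le> 1 + norm m" for x
            using norm_triangle_ineq4[of "u x" m] norm_squash_le[of "f x"] by (simp add: u_def)
          show "(\<integral>x. u x - m \<partial>M) = 0"
            using u_integrable by (simp add: m_def base.prob_space)
          show "AE x in M. u (S t x) - m = character l t * (u x - m)" if "t \<in> L" for t
            using u_eigen[OF that]
            by (rule eventually_mono) (simp only: right_diff_distrib m_eigen[OF that, symmetric])
        qed
        with directional show False
          unfolding directional_weak_mixing_def by (elim notE bexE, intro bexI exI)
      qed
      then have "AE x in M. f x = m / of_real (1 - norm m)"
      proof (rule eventually_mono)
        fix x assume "u x - m = 0"
        then have "squash (f x) = m" by (simp add: u_def)
        with unsquash[of "f x"] show "f x = m / of_real (1 - norm m)" by (simp only:)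
      qed
      then show "\<exists>c. AE x in M. f x = c" by (rule exI)
    qed
  next
    assume wm: "weak_mixing_on L M S"
    show "directional_weak_mixing L M T"
      unfolding directional_weak_mixing_def
    proof (intro notI, elim bexE exE)
      fix F l assume FO: "F \<in> L2_O M" and "eigenfunction_on L (susp_measure M) (suspension T) l F"
      then have F [measurable]: "F \<in> borel_measurable P"
        and nz: "\<not> (AE y in P. F y = 0)"
        and eigen: "\<And>t. t \<in> L \<Longrightarrow> AE y in P. F (suspension T t y) = character l t * F y"
        by (simp_all add: eigenfunction_on_def L2_def susp_measure_def)
      have "\<exists>g\<in>borel_measurable unit_cube. AE y in P. squash (F y) = g (snd y)"
      proof (rule suspension_eigenfunction_fibre[OF wm L])
        show "(\<lambda>y. squash (F y)) \<in> borel_measurable P" by measurable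
        show "norm (squash (F y)) \<le> 1" for y by (rule norm_squash_le)
        show "AE y in P. squash (F (suspension T t y)) = character l t * squash (F y)" if "t \<in> L" for t
          using eigen[OF that] by (rule eventually_mono) (simp add: squash_unimodular)
      qed
      then obtain g where g [measurable]: "g \<in> borel_measurable unit_cube"
        and Fg: "AE y in P. squash (F y) = g (snd y)"
        by (elim bexE)
      define h where "h r = g r / of_real (1 - norm (g r))" for r
      have "AE y in P. F y = h (snd y)"
        using Fg
      proof (rule eventually_mono)
        fix y assume "squash (F y) = g (snd y)"
        with unsquash[of "F y"] show "F y = h (snd y)" by (simp only: h_def)
      qed
      moreover have "h \<in> borel_measurable unit_cube" unfolding h_def by measurable
      ultimately have "AE y in P. F y = 0" by (intro L2_O_fibre_imp_zero[OF FO])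
      with nz show False ..
    qed
  qed
qed

end
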